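(* Let $V_\alpha\in\mathbb{C}^{m\times p}$ be the Vandermonde matrix with entries $(V_\alpha)_{jk}=\alpha_j^{k-1}$, where the nodes $\alpha_1,\dots,\alpha_m$ are distinct and contained in the disk $E:=\{z\in\mathbb{C}: |z-z_0|<\eta_0\}$ with $z_0\neq 0$, and where $E$ is contained in the open unit disk. Let $N=\min(m,p)$. Then for $0\le j\le N-1$, \[ \sigma_{j+1}(V_\alpha)\le h^{-j}\,\|V_\alpha\|_2, \] where \[ h =\left|\frac{ z_0 - |z_0|\beta (z_0+\eta_0) }{ |z_0|(z_0+\eta_0)-\beta z_0} \right|, \qquad \beta = \frac{1}{2|z_0|}\left(1 + c - \sqrt{(1+c)^2-4|z_0|^2}\right), \qquad c = |z_0|^2 - \eta_0^2 . \]
   Context: $\sigma_1(X)\ge\sigma_2(X)\ge\cdots\ge\sigma_N(X)$ denote the singular values of a matrix $X\in\mathbb{C}^{m\times p}$, $N=\min(m,p)$, and $\|X\|_2=\sigma_1(X)$ is the spectral norm. Here $z_0\in\mathbb{C}$ and $\eta_0>0$ is real.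
   Formalization: The denominator of h is assumed nonzero; this excludes only the case of z_0 a positive real with z_0+η_0=1 (e.g. z_0=η_0=1/2), where β=1 and the formula for h is 0/0, hence undefined. *)

theory Defs
  imports
    "Jordan_Normal_Form.Schur_Decomposition"
    "HOL-Computational_Algebra.Fundamental_Theorem_Algebra"
begin

(* The square roots of the min(m,p) largest eigenvalues of X^*X, in decreasing order and
   repeated according to algebraic multiplicity.  These eigenvalues are real and nonnegative,
   so taking real parts loses nothing.  X^*X has p eigenvalues; if p > m, the p - m entries
   that are dropped are zero. *)
definition singular_values :: "complex mat \<Rightarrow> real list" where
  "singular_values X =
     take (min (dim_row X) (dim_col X))
       (rev (sorted_list_of_multiset
          (image_mset (\<lambda>z. sqrt (Re z)) (proots (char_poly (mat_adjoint X * X))))))"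

(* 1-based; meaningful for 1 <= k <= min(m,p). *)
definition singular_value :: "nat \<Rightarrow> complex mat \<Rightarrow> real" where
  "singular_value k X = singular_values X ! (k - 1)"

definition spectral_norm :: "complex mat \<Rightarrow> real" where
  "spectral_norm X = singular_value 1 X"

(* The nodes are \<alpha> 0, ..., \<alpha> (m - 1); with both indices counted from 0, the
   exponent k - 1 of the 1-based convention becomes k. *)
definition vandermonde_mat :: "nat \<Rightarrow> nat \<Rightarrow> (nat \<Rightarrow> complex) \<Rightarrow> complex mat" where
  "vandermonde_mat m p \<alpha> = mat m p (\<lambda>(j, k). \<alpha> j ^ k)"

lemma length_singular_values:
  "length (singular_values X) = min (dim_row X) (dim_col X)"
proof -
  have "mat_adjoint X * X \<in> carrier_mat (dim_col X) (dim_col X)"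
    by (auto simp: mat_adjoint_def)
  then have "size (proots (char_poly (mat_adjoint X * X))) = dim_col X"
    by (simp add: size_proots_complex degree_monic_char_poly)
  moreover have "length (sorted_list_of_multiset M) = size M" for M :: "real multiset"
    by (metis mset_sorted_list_of_multiset size_mset)
  ultimately show ?thesis
    by (simp add: singular_values_def)
qed

lemma sorted_singular_values: "sorted_wrt (\<ge>) (singular_values X)"
  by (simp add: singular_values_def sorted_wrt_take sorted_wrt_rev)

end

theory Submission
  imports Defs
begin

text \<open>
Identify a vector of \<open>\<complex>\<^sup>p\<close> with the polynomial of degree less than \<open>p\<close> that has its entries as
coefficients; then the Vandermonde matrix \<open>V\<close> evaluates this polynomial at the nodes. For a complex
number \<open>b\<close> compare the polynomials \<open>q = (z - b)\<^sup>j g\<close> and \<open>y = (1 - cnj b * z)\<^sup>j g\<close>. The factors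
\<open>z - b\<close> and \<open>1 - cnj b * z\<close> have equal modulus on the unit circle, so \<open>q\<close> and \<open>y\<close> have the same coefficient
norm (\<open>coeff_sqnorm_reflect_root_power\<close>). If \<open>h \<bar>\<alpha> - b\<bar> \<le> \<bar>1 - cnj b * \<alpha>\<bar>\<close> at every node \<open>\<alpha>\<close>,
then \<open>h\<^sup>j \<bar>q \<alpha>\<bar> \<le> \<bar>y \<alpha>\<bar>\<close>, whence \<open>h\<^sup>j \<parallel>V q\<parallel> \<le> \<parallel>V y\<parallel> \<le> \<parallel>V\<parallel> \<parallel>y\<parallel> = \<parallel>V\<parallel> \<parallel>q\<parallel>\<close>. The \<open>q\<close> of this form
and of degree less than \<open>p\<close> form a subspace of codimension \<open>j\<close>, and the Courant--Fischer principle (\<open>singular_value_le_of_codim\<close>) gives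
\<open>\<sigma>\<^sub>j\<^sub>+\<^sub>1 \<le> h\<^sup>-\<^sup>j \<parallel>V\<parallel>\<close> (\<open>vandermonde_singular_value_decay\<close>).

It remains to choose \<open>b\<close>. The number \<open>\<beta>\<close> is such that, for \<open>b = \<beta> z\<^sub>0 / \<bar>z\<^sub>0\<bar>\<close>, the Blaschke factor
\<open>(z - b) / (1 - cnj b * z)\<close> has constant modulus on the boundary circle of the disk that contains the
nodes; this constant is \<open>1 / h\<close>, and it bounds the modulus inside the disk
(\<open>disk_blaschke_bound\<close>).

The variational description of singular values comes from the spectral theorem for the Hermitian
matrix \<open>mat_adjoint X * X\<close> (\<open>hermitian_unitary_diagonalization\<close>).\<close>

section \<open>A Blaschke factor on a disk\<close>

lemma cmod_blaschke_diff:
  "(cmod (1 - cnj b * w))\<^sup>2 - (cmod (w - b))\<^sup>2 = (1 - (cmod b)\<^sup>2) * (1 - (cmod w)\<^sup>2)"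
  unfolding cmod_power2 by (simp add: power2_eq_square algebra_simps)

lemma blaschke_le_one:
  assumes "cmod b \<le> 1" "cmod w \<le> 1"
  shows "cmod (w - b) \<le> cmod (1 - cnj b * w)"
proof (rule power2_le_imp_le)
  have "0 \<le> (1 - (cmod b)\<^sup>2) * (1 - (cmod w)\<^sup>2)"
    using assms by (simp add: power_le_one)
  then show "(cmod (w - b))\<^sup>2 \<le> (cmod (1 - cnj b * w))\<^sup>2"
    unfolding cmod_blaschke_diff[symmetric] by simp
qed simp

text \<open>The quadratic equation for \<open>t\<close> says that the Blaschke factor \<open>u \<mapsto> (u - b) / (1 - cnj b * u)\<close>
has constant modulus on the circle \<open>\<bar>u - z\<^sub>0\<bar> = \<eta>\<close>. The lemma bounds this modulus at a point \<open>a\<close> of the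
disk by its value at a point \<open>w\<close> of the circle. With the denominators multiplied out, the difference
of the squared sides is \<open>s a\<close> times a nonnegative number, where \<open>s u = \<bar>u - z\<^sub>0\<bar>\<^sup>2 - \<eta>\<^sup>2\<close>, so that no
maximum principle is needed and the degenerate case \<open>\<bar>b\<bar> = 1\<close> is included.\<close>
lemma disk_blaschke_bound:
  fixes a w z\<^sub>0 b :: complex and r t \<eta> c :: real
  assumes b: "b = complex_of_real t * z\<^sub>0" and r: "r = cmod z\<^sub>0"
    and c: "c = r\<^sup>2 - \<eta>\<^sup>2"
    and t: "t\<^sup>2 * r\<^sup>2 - (1 + c) * t + 1 = 0"
    and b1: "cmod b \<le> 1" and w1: "cmod w \<le> 1"
    and w: "cmod (w - z\<^sub>0) = \<eta>" and a: "cmod (a - z\<^sub>0) \<le> \<eta>"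
  shows "cmod (a - b) * cmod (1 - cnj b * w) \<le> cmod (w - b) * cmod (1 - cnj b * a)"
proof -
  define X where "X = (\<lambda>u. Re (cnj z\<^sub>0 * u))"
  define s where "s = (\<lambda>u. (cmod u)\<^sup>2 - 2 * X u + c)"
  have dist: "(cmod (u - z\<^sub>0))\<^sup>2 = s u + \<eta>\<^sup>2" for u
    unfolding s_def X_def c r cmod_power2 by (simp add: power2_eq_square algebra_simps)
  have T: "t\<^sup>2 * r\<^sup>2 = (1 + c) * t - 1" using t by linarith
  \<comment> \<open>by the quadratic equation, numerator and denominator are combinations of \<open>s\<close> and the same \<open>L\<close>\<close>
  define L where "L = (\<lambda>u. 2 * X u - 1 - c)"
  have num: "(cmod (u - b))\<^sup>2 = s u + (1 - t) * L u" for u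
  proof -
    have "(cmod (u - b))\<^sup>2 = s u + 2 * X u - c - 2 * t * X u + t\<^sup>2 * r\<^sup>2"
      unfolding s_def X_def r b cmod_power2 by (simp add: power2_eq_square algebra_simps)
    then show ?thesis
      unfolding T L_def by (simp add: algebra_simps)
  qed
  have den: "(cmod (1 - cnj b * u))\<^sup>2 = t\<^sup>2 * r\<^sup>2 * s u + (c * t - 1) * L u" for u
  proof -
    have "(cmod (1 - cnj b * u))\<^sup>2 = t\<^sup>2 * r\<^sup>2 * s u + 1 - 2 * t * X u + t\<^sup>2 * r\<^sup>2 * (2 * X u - c)"
      unfolding s_def X_def r b cmod_power2 by (simp add: power2_eq_square algebra_simps)
    then show ?thesis
      unfolding T L_def by (simp add: algebra_simps)
  qed
  have b2: "(cmod b)\<^sup>2 = t\<^sup>2 * r\<^sup>2"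
    by (simp add: b r norm_mult power_mult_distrib)
  have sw: "s w = 0" using dist[of w] w by simp
  have sa: "s a \<le> 0"
    using dist[of a] power_mono[OF a, of 2] by simp
  have "(cmod (w - b))\<^sup>2 \<le> (cmod (1 - cnj b * w))\<^sup>2"
    using blaschke_le_one[OF b1 w1] by simp
  moreover have "(cmod b)\<^sup>2 * (cmod (w - b))\<^sup>2 \<le> (cmod (w - b))\<^sup>2"
    using b1 by (simp add: mult_left_le_one_le power_le_one)
  ultimately have gap: "0 \<le> (cmod (1 - cnj b * w))\<^sup>2 - t\<^sup>2 * r\<^sup>2 * (cmod (w - b))\<^sup>2"
    unfolding b2 by linarith
  have "(cmod (a - b))\<^sup>2 * (cmod (1 - cnj b * w))\<^sup>2 - (cmod (w - b))\<^sup>2 * (cmod (1 - cnj b * a))\<^sup>2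
      = s a * ((cmod (1 - cnj b * w))\<^sup>2 - t\<^sup>2 * r\<^sup>2 * (cmod (w - b))\<^sup>2)"
    unfolding num den sw by (simp add: algebra_simps)
  also have "\<dots> \<le> 0"
    using sa gap by (rule mult_nonpos_nonneg)
  finally have "(cmod (a - b) * cmod (1 - cnj b * w))\<^sup>2 \<le> (cmod (w - b) * cmod (1 - cnj b * a))\<^sup>2"
    by (simp add: power_mult_distrib)
  then show ?thesis
    by (rule power2_le_imp_le) simp
qed

section \<open>The coefficient norm of a polynomial\<close>

text \<open>The squared Euclidean norm of the coefficient sequence, that is, the squared \<open>L\<^sup>2\<close> norm of the
polynomial on the unit circle with normalized arc length.\<close>
definition coeff_sqnorm :: "complex poly \<Rightarrow> real" where
  "coeff_sqnorm q = (\<Sum>i\<le>degree q. (cmod (coeff q i))\<^sup>2)"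

lemma coeff_sqnorm_eq_sum:
  assumes "degree q < n"
  shows "coeff_sqnorm q = (\<Sum>i<n. (cmod (coeff q i))\<^sup>2)"
  unfolding coeff_sqnorm_def
  by (rule sum.mono_neutral_left) (use assms in \<open>auto simp: coeff_eq_0\<close>)

text \<open>Since \<open>\<bar>z - b\<bar> = \<bar>1 - cnj b * z\<bar>\<close> on the unit circle, replacing one factor by the other keeps the norm.
On coefficients, the difference of the two sums telescopes.\<close>
lemma coeff_sqnorm_reflect_root:
  "coeff_sqnorm ([:- b, 1:] * g) = coeff_sqnorm ([:1, - cnj b:] * g)"
proof -
  define n where "n = degree g + 2"
  have "degree ([:u, v:] * g) < n" for u v :: complex
    using degree_mult_le[of "[:u, v:]" g] degree_pCons_le[of u "[:v:]"] unfolding n_def by simp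
  then have sums: "coeff_sqnorm ([:u, v:] * g) = (\<Sum>i<n. (cmod (coeff ([:u, v:] * g) i))\<^sup>2)" for u v
    by (rule coeff_sqnorm_eq_sum)
  \<comment> \<open>the squared moduli of the coefficients of \<open>g\<close>, shifted by one, with a zero in front\<close>
  define f where "f = (\<lambda>i. case i of 0 \<Rightarrow> 0 | Suc k \<Rightarrow> (cmod (coeff g k))\<^sup>2)"
  have "(cmod (coeff ([:- b, 1:] * g) i))\<^sup>2 - (cmod (coeff ([:1, - cnj b:] * g) i))\<^sup>2
      = ((cmod b)\<^sup>2 - 1) * (f (Suc i) - f i)" for i
    by (cases i; simp add: f_def cmod_power2 mult_pCons_left; simp add: power2_eq_square algebra_simps)
  then have "coeff_sqnorm ([:- b, 1:] * g) - coeff_sqnorm ([:1, - cnj b:] * g)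
      = ((cmod b)\<^sup>2 - 1) * (\<Sum>i<n. f (Suc i) - f i)"
    unfolding sums by (simp add: sum_subtractf [symmetric] sum_distrib_left)
  also have "(\<Sum>i<n. f (Suc i) - f i) = f n - f 0"
    by (rule sum_lessThan_telescope)
  also have "\<dots> = 0"
    by (simp add: f_def n_def coeff_eq_0)
  finally show ?thesis by simp
qed

lemma coeff_sqnorm_reflect_root_power:
  "coeff_sqnorm ([:- b, 1:] ^ j * g) = coeff_sqnorm ([:1, - cnj b:] ^ j * g)"
proof (induction j arbitrary: g)
  case (Suc j)
  have "coeff_sqnorm ([:- b, 1:] ^ Suc j * g) = coeff_sqnorm ([:- b, 1:] ^ j * ([:- b, 1:] * g))"
    by (simp only: power_Suc2 mult.assoc)
  also have "\<dots> = coeff_sqnorm ([:1, - cnj b:] ^ j * ([:- b, 1:] * g))"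
    by (rule Suc.IH)
  also have "\<dots> = coeff_sqnorm ([:- b, 1:] * ([:1, - cnj b:] ^ j * g))"
    by (simp only: mult.left_commute)
  also have "\<dots> = coeff_sqnorm ([:1, - cnj b:] * ([:1, - cnj b:] ^ j * g))"
    by (rule coeff_sqnorm_reflect_root)
  finally show ?case
    by (simp only: power_Suc mult.assoc)
qed simp

section \<open>Adjoints and Gram matrices\<close>

lemma mat_adjoint_carrier [simp]:
  "A \<in> carrier_mat n k \<Longrightarrow> mat_adjoint A \<in> carrier_mat k n"
  by (auto simp: mat_adjoint_def)

lemma dim_mat_adjoint [simp]:
  "dim_row (mat_adjoint A) = dim_col A" "dim_col (mat_adjoint A) = dim_row A"
  by (auto simp: mat_adjoint_def)

lemma index_mat_adjoint [simp]:
  "i < dim_col A \<Longrightarrow> k < dim_row A \<Longrightarrow> mat_adjoint A $$ (i, k) = conjugate (A $$ (k, i))"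
  by (simp add: mat_adjoint_def mat_of_rows_index)

lemma mat_adjoint_mult:
  fixes A B :: "complex mat"
  assumes "A \<in> carrier_mat n k" "B \<in> carrier_mat k l"
  shows "mat_adjoint (A * B) = mat_adjoint B * mat_adjoint A"
  by (rule eq_matI) (use assms in \<open>auto simp: scalar_prod_def mult.commute\<close>)

lemma mat_adjoint_adjoint: "mat_adjoint (mat_adjoint A) = A"
  by (rule eq_matI) auto

lemma cscalar_prod_mult_mat_vec:
  fixes A :: "complex mat"
  assumes "A \<in> carrier_mat n k" "x \<in> carrier_vec k" "y \<in> carrier_vec n"
  shows "(A *\<^sub>v x) \<bullet>c y = x \<bullet>c (mat_adjoint A *\<^sub>v y)"
proof -
  have "(A *\<^sub>v x) \<bullet>c y = (\<Sum>i<n. \<Sum>l<k. A $$ (i, l) * x $ l * cnj (y $ i))"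
    using assms by (simp add: scalar_prod_def lessThan_atLeast0 sum_distrib_right)
  also have "\<dots> = (\<Sum>l<k. \<Sum>i<n. A $$ (i, l) * x $ l * cnj (y $ i))"
    by (rule sum.swap)
  also have "\<dots> = x \<bullet>c (mat_adjoint A *\<^sub>v y)"
    using assms by (simp add: scalar_prod_def lessThan_atLeast0 sum_distrib_left mult_ac)
  finally show ?thesis .
qed

text \<open>The squared Euclidean norm of a complex vector, as a real number.\<close>
definition vec_sqnorm :: "complex vec \<Rightarrow> real" where
  "vec_sqnorm v = (\<Sum>i<dim_vec v. (cmod (v $ i))\<^sup>2)"

lemma cscalar_prod_self: "v \<bullet>c v = complex_of_real (vec_sqnorm v)"
  by (simp add: scalar_prod_def vec_sqnorm_def lessThan_atLeast0 flip: complex_norm_square)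

lemma vec_sqnorm_nonneg: "0 \<le> vec_sqnorm v"
  by (simp add: vec_sqnorm_def sum_nonneg)

lemma vec_sqnorm_eq_0_iff:
  "v \<in> carrier_vec n \<Longrightarrow> vec_sqnorm v = 0 \<longleftrightarrow> v = 0\<^sub>v n"
  by (auto simp: vec_sqnorm_def sum_nonneg_eq_0_iff intro!: eq_vecI)

lemma gram_diag:
  assumes "Y \<in> carrier_mat n k" "i < k"
  shows "(mat_adjoint Y * Y) $$ (i, i) = complex_of_real (vec_sqnorm (col Y i))"
proof -
  have "(mat_adjoint Y * Y) $$ (i, i) = col Y i \<bullet>c col Y i"
    using assms by (simp add: scalar_prod_def mult.commute)
  then show ?thesis by (simp add: cscalar_prod_self)
qed

lemma vec_sqnorm_mult_diag_gram:
  assumes Y: "Y \<in> carrier_mat n k" and x: "x \<in> carrier_vec k"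
    and gram: "mat_adjoint Y * Y = mat k k (\<lambda>(i, l). if i = l then complex_of_real (d i) else 0)"
  shows "vec_sqnorm (Y *\<^sub>v x) = (\<Sum>i<k. d i * (cmod (x $ i))\<^sup>2)"
proof -
  let ?D = "mat k k (\<lambda>(i, l). if i = l then complex_of_real (d i) else 0)"
  have Dx: "(?D *\<^sub>v x) $ i = complex_of_real (d i) * x $ i" if "i < k" for i
  proof -
    have "(?D *\<^sub>v x) $ i = (\<Sum>l<k. (if i = l then complex_of_real (d i) else 0) * x $ l)"
      using x that by (simp add: scalar_prod_def lessThan_atLeast0)
    also have "\<dots> = (\<Sum>l<k. if i = l then complex_of_real (d i) * x $ l else 0)"
      by (intro sum.cong) auto
    finally show ?thesis using that by simp
  qed
  have "complex_of_real (vec_sqnorm (Y *\<^sub>v x)) = x \<bullet>c (mat_adjoint Y *\<^sub>v (Y *\<^sub>v x))"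
    using cscalar_prod_mult_mat_vec[OF Y x, of "Y *\<^sub>v x"] Y x by (simp add: cscalar_prod_self)
  also have "mat_adjoint Y *\<^sub>v (Y *\<^sub>v x) = ?D *\<^sub>v x"
    using Y x by (simp add: assoc_mult_mat_vec[symmetric, of _ k n _ k] gram)
  also have "x \<bullet>c (?D *\<^sub>v x) = (\<Sum>i<k. x $ i * cnj (complex_of_real (d i) * x $ i))"
    using x Dx by (simp add: scalar_prod_def lessThan_atLeast0 del: index_mult_mat_vec)
  also have "\<dots> = (\<Sum>i<k. complex_of_real (d i) * (x $ i * cnj (x $ i)))"
    by (simp add: mult_ac)
  also have "\<dots> = complex_of_real (\<Sum>i<k. d i * (cmod (x $ i))\<^sup>2)"
    by (simp flip: complex_norm_square)
  finally show ?thesis by (simp only: of_real_eq_iff)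
qed


section \<open>Unitary diagonalization of Hermitian matrices\<close>

text \<open>Gram--Schmidt orthogonalization and normalization of a basis that starts with \<open>v\<close>.\<close>
lemma unitary_completion:
  fixes v :: "complex vec"
  assumes v: "v \<in> carrier_vec n" and v0: "v \<noteq> 0\<^sub>v n"
  obtains W a where "W \<in> carrier_mat n n" "mat_adjoint W * W = 1\<^sub>m n" "col W 0 = a \<cdot>\<^sub>v v"
proof -
  interpret cof_vec_space n "TYPE(complex)" .
  define B where "B = basis_completion v"
  define ws where "ws = gram_schmidt n B"
  from basis_completion[OF v v0, folded B_def]
  have dist: "distinct B" and indep: "\<not> lin_dep (set B)" and B: "set B \<subseteq> carrier_vec n"
    and hdB: "hd B = v" and lenB: "length B = n" by auto
  have "n \<noteq> 0"
    using v v0 by auto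
  with hdB lenB obtain vs where Bv: "B = v # vs" by (cases B) auto
  from gram_schmidt_result[OF B dist indep refl, folded ws_def]
  have ws: "set ws \<subseteq> carrier_vec n" and orth: "corthogonal ws" and len: "length ws = n"
    by (auto simp: lenB)
  have "hd ws = v"
    using gram_schmidt_hd[OF v, of vs, folded Bv] by (simp add: ws_def)
  then have ws0: "ws ! 0 = v"
    using \<open>n \<noteq> 0\<close> len by (cases ws) auto
  have wsi [simp]: "ws ! i \<in> carrier_vec n" if "i < n" for i
    using ws len that by auto
  define \<nu> where "\<nu> = (\<lambda>w. complex_of_real (1 / sqrt (vec_sqnorm w)))"
  define W where "W = mat n n (\<lambda>(i, k). \<nu> (ws ! k) * ws ! k $ i)"
  have W: "W \<in> carrier_mat n n" by (simp add: W_def)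
  have "(mat_adjoint W * W) $$ (i, k) = 1\<^sub>m n $$ (i, k)" if "i < n" "k < n" for i k
  proof -
    have "(mat_adjoint W * W) $$ (i, k)
        = (\<Sum>l<n. cnj (\<nu> (ws ! i) * ws ! i $ l) * (\<nu> (ws ! k) * ws ! k $ l))"
      using that by (simp add: W_def scalar_prod_def lessThan_atLeast0)
    also have "\<dots> = cnj (\<nu> (ws ! i)) * \<nu> (ws ! k) * (ws ! k \<bullet>c ws ! i)"
      using wsi[OF that(1)] wsi[OF that(2)]
      by (simp add: scalar_prod_def lessThan_atLeast0 sum_distrib_left mult_ac)
    also have "\<dots> = 1\<^sub>m n $$ (i, k)"
    proof (cases "i = k")
      case True
      have "ws ! i \<bullet>c ws ! i \<noteq> 0"
        using corthogonalD[OF orth, of i i] that len by simp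
      then have "vec_sqnorm (ws ! i) > 0"
        using vec_sqnorm_nonneg[of "ws ! i"] by (simp add: cscalar_prod_self)
      then have "1 / sqrt (vec_sqnorm (ws ! i)) * (1 / sqrt (vec_sqnorm (ws ! i))) * vec_sqnorm (ws ! i) = 1"
        by (simp add: field_simps)
      then have "cnj (\<nu> (ws ! i)) * \<nu> (ws ! i) * (ws ! i \<bullet>c ws ! i) = 1"
        unfolding \<nu>_def cscalar_prod_self complex_cnj_complex_of_real
        by (simp only: of_real_mult [symmetric] of_real_1)
      with True that show ?thesis by simp
    next
      case False
      then show ?thesis
        using corthogonalD[OF orth, of k i] that len by simp
    qed
    finally show ?thesis .
  qed
  then have "mat_adjoint W * W = 1\<^sub>m n"
    by (intro eq_matI) (use W in auto)
  moreover have "col W 0 = \<nu> v \<cdot>\<^sub>v v"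
    by (rule eq_vecI) (use v \<open>n \<noteq> 0\<close> in \<open>auto simp: W_def ws0\<close>)
  ultimately show thesis
    using that W by blast
qed

text \<open>The spectral theorem, with the eigenvalues in any prescribed order \<open>es\<close>. A unitary \<open>W\<close> whose first
column is an eigenvector for the first eigenvalue turns \<open>A\<close> into a block diagonal matrix, and the
induction hypothesis applies to the remaining Hermitian block.\<close>
lemma hermitian_unitary_diagonalization:
  fixes A :: "complex mat"
  assumes "A \<in> carrier_mat n n" and "mat_adjoint A = A"
    and "char_poly A = (\<Prod>e\<leftarrow>es. [:- e, 1:])"
  shows "\<exists>U \<in> carrier_mat n n. mat_adjoint U * U = 1\<^sub>m n
    \<and> mat_adjoint U * A * U = mat n n (\<lambda>(i, k). if i = k then es ! i else 0)"
  using assms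
proof (induction es arbitrary: n A)
  case Nil
  with degree_monic_char_poly[of A n] have "n = 0" by simp
  then show ?case
    using Nil by (intro bexI[of _ "1\<^sub>m n"]) (auto intro!: eq_matI)
next
  case (Cons e es n A)
  note A = Cons.prems(1) and herm = Cons.prems(2)
  have "degree (char_poly A) = n"
    using degree_monic_char_poly[OF A] by simp
  moreover have "degree (char_poly A) \<noteq> 0"
  proof
    assume "degree (char_poly A) = 0"
    then obtain u where "char_poly A = [:u:]" by (rule degree_eq_zeroE)
    moreover have "poly (char_poly A) e = 0" using Cons.prems(3) by simp
    ultimately show False using degree_monic_char_poly[OF A] by auto
  qed
  ultimately obtain k where n: "n = Suc k" by (cases n) auto
  have "eigenvalue A e"
    using eigenvalue_root_char_poly[OF A] Cons.prems(3) by simp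
  then obtain v where v: "v \<in> carrier_vec n" and v0: "v \<noteq> 0\<^sub>v n" and Av: "A *\<^sub>v v = e \<cdot>\<^sub>v v"
    using A unfolding eigenvalue_def eigenvector_def by auto
  obtain W a where W: "W \<in> carrier_mat n n" and WW: "mat_adjoint W * W = 1\<^sub>m n"
    and W0: "col W 0 = a \<cdot>\<^sub>v v"
    using unitary_completion[OF v v0] .
  have WW': "W * mat_adjoint W = 1\<^sub>m n"
    using mat_mult_left_right_inverse[OF mat_adjoint_carrier[OF W] W WW] .
  note [simp] = A W mat_adjoint_carrier[OF W] mult_carrier_mat[of _ n n _ n]
  \<comment> \<open>the first column of \<open>A'\<close> is \<open>e\<close> times a unit vector; since \<open>A'\<close> is Hermitian, so is its first row\<close>
  define A' where "A' = mat_adjoint W * A * W"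
  have A': "A' \<in> carrier_mat n n" by (simp add: A'_def)
  have "similar_mat A' A"
    unfolding similar_mat_def
    by (intro exI, rule similar_mat_witI[OF WW WW' A'_def]) (auto simp: A')
  then have char_A': "char_poly A' = [:- e, 1:] * (\<Prod>e\<leftarrow>es. [:- e, 1:])"
    using char_poly_similar[of A' A] Cons.prems(3) by simp
  have herm': "mat_adjoint A' = A'"
    unfolding A'_def
    by (simp add: mat_adjoint_mult[of _ n n _ n] mat_adjoint_adjoint herm
        assoc_mult_mat[of _ n n _ n _ n])
  have "A' = mat_adjoint W * (A * W)"
    unfolding A'_def by (rule assoc_mult_mat[OF mat_adjoint_carrier[OF W] A W])
  then have "col A' 0 = mat_adjoint W *\<^sub>v (A *\<^sub>v col W 0)"
    using n by (simp add: col_mult2[OF mat_adjoint_carrier[OF W] mult_carrier_mat[OF A W]] col_mult2[OF A W])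
  also have "A *\<^sub>v col W 0 = e \<cdot>\<^sub>v col W 0"
    using v by (simp add: W0 Av mult_mat_vec[of _ n n] smult_smult_assoc mult.commute)
  also have "mat_adjoint W *\<^sub>v (e \<cdot>\<^sub>v col W 0) = e \<cdot>\<^sub>v col (mat_adjoint W * W) 0"
    using n col_mult2[OF mat_adjoint_carrier[OF W] W]
      mult_mat_vec[OF mat_adjoint_carrier[OF W], of "col W 0" e] W by auto
  finally have col0: "col A' 0 = e \<cdot>\<^sub>v unit_vec n 0"
    using n by (simp add: WW)
  have A'0: "A' $$ (i, 0) = (if i = 0 then e else 0)" if "i < n" for i
    using arg_cong[OF col0, of "\<lambda>v. v $ i"] that A' n by (auto simp: unit_vec_def)
  have A'0': "A' $$ (0, i) = 0" if "i < n" "i \<noteq> 0" for i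
    using arg_cong[OF herm', of "\<lambda>M. M $$ (0, i)"] A'0[OF that(1)] that A' n by auto
  define E where "E = mat 1 1 (\<lambda>_. e)"
  define A3 where "A3 = mat k k (\<lambda>(i, l). A' $$ (Suc i, Suc l))"
  have E: "E \<in> carrier_mat 1 1" and A3: "A3 \<in> carrier_mat k k"
    by (simp_all add: E_def A3_def)
  have block: "A' = four_block_mat E (0\<^sub>m 1 k) (0\<^sub>m k 1) A3"
    by (rule eq_matI) (use A' n A'0 A'0' in \<open>auto simp: E_def A3_def\<close>)
  have "char_poly E = [:- e, 1:]"
    by (simp add: E_def char_poly_defs det_def sign_def)
  then have "char_poly A3 = (\<Prod>e\<leftarrow>es. [:- e, 1:])"
    using char_A' char_poly_four_block_zeros_col[OF E _ A3, of "0\<^sub>m 1 k"] block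
    by (metis mult_cancel_left pCons_eq_0_iff zero_carrier_mat zero_neq_one)
  moreover have "mat_adjoint A3 = A3"
  proof (rule eq_matI)
    fix i l assume "i < dim_row A3" "l < dim_col A3"
    then show "mat_adjoint A3 $$ (i, l) = A3 $$ (i, l)"
      using arg_cong[OF herm', of "\<lambda>M. M $$ (Suc i, Suc l)"] A' n by (simp add: A3_def)
  qed (use A3 in auto)
  ultimately obtain U where U: "U \<in> carrier_mat k k" and UU: "mat_adjoint U * U = 1\<^sub>m k"
    and UAU: "mat_adjoint U * A3 * U = mat k k (\<lambda>(i, l). if i = l then es ! i else 0)"
    using Cons.IH[OF A3] by blast
  \<comment> \<open>\<open>J M\<close> extends \<open>M\<close> by the identity on the first coordinate\<close>
  define J where "J = (\<lambda>M :: complex mat. four_block_mat (1\<^sub>m 1) (0\<^sub>m 1 k) (0\<^sub>m k 1) M)"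
  have J: "J U \<in> carrier_mat n n" "J (mat_adjoint U) \<in> carrier_mat n n"
    using four_block_carrier_mat[OF one_carrier_mat[of 1] U]
      four_block_carrier_mat[OF one_carrier_mat[of 1] mat_adjoint_carrier[OF U]]
    by (simp_all add: J_def n)
  have adjJ: "mat_adjoint (J U) = J (mat_adjoint U)"
    by (rule eq_matI) (use U in \<open>auto simp: J_def\<close>)
  have JJ: "J (mat_adjoint U) * J U = 1\<^sub>m n"
  proof -
    have "J (mat_adjoint U) * J U = four_block_mat (1\<^sub>m 1) (0\<^sub>m 1 k) (0\<^sub>m k 1) (1\<^sub>m k)"
      unfolding J_def using U UU
      by (subst mult_four_block_mat[of _ 1 1 _ k _ k _ _ 1 _ k]) auto
    also have "\<dots> = 1\<^sub>m n"
      using n by (intro eq_matI) auto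
    finally show ?thesis .
  qed
  have JAJ: "J (mat_adjoint U) * A' * J U = mat n n (\<lambda>(i, l). if i = l then (e # es) ! i else 0)"
  proof -
    have "J (mat_adjoint U) * A' = four_block_mat E (0\<^sub>m 1 k) (0\<^sub>m k 1) (mat_adjoint U * A3)"
      unfolding J_def block using U E A3
      by (subst mult_four_block_mat[of _ 1 1 _ k _ k _ _ 1 _ k]) auto
    then have "J (mat_adjoint U) * A' * J U
        = four_block_mat E (0\<^sub>m 1 k) (0\<^sub>m k 1) (mat_adjoint U * A3 * U)"
      unfolding J_def using U E A3
      by (simp, subst mult_four_block_mat[of _ 1 1 _ k _ k _ _ 1 _ k]) auto
    also have "\<dots> = mat n n (\<lambda>(i, l). if i = l then (e # es) ! i else 0)"
      unfolding UAU using n by (intro eq_matI) (auto simp: E_def)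
    finally show ?thesis .
  qed
  define P where "P = W * J U"
  have P: "P \<in> carrier_mat n n" using J by (simp add: P_def)
  have adjP: "mat_adjoint P = J (mat_adjoint U) * mat_adjoint W"
    using J by (simp add: P_def mat_adjoint_mult[of _ n n _ n] adjJ)
  have "mat_adjoint P * P = J (mat_adjoint U) * (mat_adjoint W * W) * J U"
    unfolding adjP unfolding P_def using J by (simp add: assoc_mult_mat[of _ n n _ n _ n])
  also have "\<dots> = 1\<^sub>m n"
    using J JJ by (simp add: WW)
  finally have "mat_adjoint P * P = 1\<^sub>m n" .
  moreover have "mat_adjoint P * A * P = J (mat_adjoint U) * A' * J U"
    unfolding adjP unfolding P_def A'_def using J by (simp add: assoc_mult_mat[of _ n n _ n _ n])
  ultimately show ?case
    using P JAJ by auto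
qed

section \<open>Variational bounds for singular values\<close>

text \<open>An orthonormal basis of right singular vectors, as the columns of \<open>U\<close>. There are \<open>p\<close> numbers \<open>s\<close>,
of which only the first \<open>min m p\<close> count as singular values of \<open>X\<close>.\<close>
lemma singular_value_basis:
  assumes X: "X \<in> carrier_mat m p"
  obtains U s where "U \<in> carrier_mat p p" "mat_adjoint U * U = 1\<^sub>m p"
    "mat_adjoint (X * U) * (X * U) = mat p p (\<lambda>(i, k). if i = k then complex_of_real ((s i)\<^sup>2) else 0)"
    "\<forall>i<p. 0 \<le> s i" "\<forall>k<p. \<forall>i\<le>k. s k \<le> s i"
    "\<forall>k<min m p. singular_value (k + 1) X = s k"
proof -
  define A where "A = mat_adjoint X * X"
  have A: "A \<in> carrier_mat p p"
    using X by (simp add: A_def mult_carrier_mat[of _ p m _ p])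
  have herm: "mat_adjoint A = A"
    using X by (simp add: A_def mat_adjoint_mult[of _ p m _ p] mat_adjoint_adjoint)
  obtain xs where xs: "mset xs = proots (char_poly A)"
    using ex_mset by blast
  define f where "f = (\<lambda>z. sqrt (Re z))"
  \<comment> \<open>the eigenvalues of the Gram matrix, ordered so that the square roots decrease\<close>
  define es where "es = rev (sort_key f xs)"
  have mset_es: "mset es = proots (char_poly A)"
    by (simp add: es_def xs)
  have len: "length es = p"
    using degree_monic_char_poly[OF A] by (simp flip: size_mset add: mset_es size_proots_complex)
  have "char_poly A = (\<Prod>e\<leftarrow>es. [:- e, 1:])"
    using complex_poly_decompose_multiset[of "char_poly A"] degree_monic_char_poly[OF A]
    by (simp flip: mset_es mset_map prod_mset_prod_list)
  then obtain U where U: "U \<in> carrier_mat p p" and UU: "mat_adjoint U * U = 1\<^sub>m p"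
    and UAU: "mat_adjoint U * A * U = mat p p (\<lambda>(i, k). if i = k then es ! i else 0)"
    using hermitian_unitary_diagonalization[OF A herm] by blast
  have XU: "X * U \<in> carrier_mat m p"
    using X U by simp
  have "mat_adjoint (X * U) * (X * U) = mat_adjoint U * (mat_adjoint X * (X * U))"
    unfolding mat_adjoint_mult[OF X U]
    by (rule assoc_mult_mat[OF mat_adjoint_carrier[OF U] mat_adjoint_carrier[OF X] XU])
  also have "mat_adjoint X * (X * U) = A * U"
    unfolding A_def by (rule assoc_mult_mat[OF mat_adjoint_carrier[OF X] X U, symmetric])
  also have "mat_adjoint U * (A * U) = mat_adjoint U * A * U"
    by (rule assoc_mult_mat[OF mat_adjoint_carrier[OF U] A U, symmetric])
  finally have gram: "mat_adjoint (X * U) * (X * U) = mat p p (\<lambda>(i, k). if i = k then es ! i else 0)"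
    using UAU by simp
  have es: "es ! i = complex_of_real (vec_sqnorm (col (X * U) i))" if "i < p" for i
  proof -
    have "es ! i = (mat_adjoint (X * U) * (X * U)) $$ (i, i)"
      using gram that by simp
    then show ?thesis
      using gram_diag[OF XU that] by simp
  qed
  define s where "s = (\<lambda>i. f (es ! i))"
  have s: "0 \<le> s i" "es ! i = complex_of_real ((s i)\<^sup>2)" if "i < p" for i
    using es[OF that] vec_sqnorm_nonneg[of "col (X * U) i"] by (simp_all add: s_def f_def)
  have sorted: "sorted (rev (map f es))"
    by (simp add: es_def rev_map)
  have "singular_values X = take (min m p) (rev (sorted_list_of_multiset (image_mset f (mset es))))"
    using X unfolding singular_values_def f_def mset_es A_def by auto
  also have "sorted_list_of_multiset (image_mset f (mset es)) = sort (map f es)"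
    by (simp flip: mset_map)
  also have "\<dots> = rev (map f es)"
    by (rule properties_for_sort) (use sorted in auto)
  finally have "singular_values X = take (min m p) (map f es)"
    by simp
  then have "singular_value (k + 1) X = s k" if "k < min m p" for k
    using that len by (simp add: singular_value_def s_def)
  moreover have "s k \<le> s i" if "i \<le> k" "k < p" for i k
    using sorted_wrt_rev[of "(\<le>)" "map f es"] sorted that len
    by (cases "i = k") (auto simp: sorted_wrt_iff_nth_less s_def)
  moreover have "mat_adjoint (X * U) * (X * U)
      = mat p p (\<lambda>(i, k). if i = k then complex_of_real ((s i)\<^sup>2) else 0)"
    unfolding gram by (rule eq_matI) (auto simp: s(2))
  ultimately show thesis
    using that[of U s] U UU s(1) by blast
qed

lemma vec_sqnorm_unitary:
  assumes "U \<in> carrier_mat n k" "x \<in> carrier_vec k" "mat_adjoint U * U = 1\<^sub>m k"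
  shows "vec_sqnorm (U *\<^sub>v x) = vec_sqnorm x"
proof -
  have "1\<^sub>m k = mat k k (\<lambda>(i, l). if i = l then complex_of_real 1 else 0)"
    by (rule eq_matI) auto
  with assms vec_sqnorm_mult_diag_gram[of U n k x "\<lambda>_. 1"] show ?thesis
    by (simp add: vec_sqnorm_def)
qed

lemma vec_sqnorm_mult_le_spectral_norm:
  assumes X: "X \<in> carrier_mat m p" and mp: "0 < min m p" and x: "x \<in> carrier_vec p"
  shows "vec_sqnorm (X *\<^sub>v x) \<le> (spectral_norm X)\<^sup>2 * vec_sqnorm x"
proof -
  obtain U s where U: "U \<in> carrier_mat p p" and UU: "mat_adjoint U * U = 1\<^sub>m p"
    and gram: "mat_adjoint (X * U) * (X * U)
      = mat p p (\<lambda>(i, k). if i = k then complex_of_real ((s i)\<^sup>2) else 0)"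
    and s: "\<forall>i<p. 0 \<le> s i" "\<forall>k<p. \<forall>i\<le>k. s k \<le> s i"
      "\<forall>k<min m p. singular_value (k + 1) X = s k"
    using singular_value_basis[OF X] .
  have s0: "spectral_norm X = s 0"
    using s(3) mp by (simp add: spectral_norm_def)
  define y where "y = mat_adjoint U *\<^sub>v x"
  have U': "U * mat_adjoint U = 1\<^sub>m p"
    using mat_mult_left_right_inverse[OF mat_adjoint_carrier[OF U] U UU] .
  have y: "y \<in> carrier_vec p"
    using mat_adjoint_carrier[OF U] x unfolding y_def by (rule mult_mat_vec_carrier)
  have Uy: "U *\<^sub>v y = x"
    using U x mat_adjoint_carrier[OF U]
    by (simp add: y_def assoc_mult_mat_vec[symmetric, of _ p p _ p] U')
  have "vec_sqnorm (X *\<^sub>v x) = vec_sqnorm ((X * U) *\<^sub>v y)"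
    using X U y by (simp add: assoc_mult_mat_vec[of _ m p _ p] Uy)
  also have "\<dots> = (\<Sum>i<p. (s i)\<^sup>2 * (cmod (y $ i))\<^sup>2)"
    by (rule vec_sqnorm_mult_diag_gram[OF mult_carrier_mat[OF X U] y gram])
  also have "\<dots> \<le> (\<Sum>i<p. (s 0)\<^sup>2 * (cmod (y $ i))\<^sup>2)"
    by (intro sum_mono mult_right_mono power_mono) (use s in auto)
  also have "\<dots> = (s 0)\<^sup>2 * vec_sqnorm x"
    using vec_sqnorm_unitary[OF U y UU] y by (simp add: Uy vec_sqnorm_def sum_distrib_left)
  finally show ?thesis by (simp add: s0)
qed

lemma underdetermined_nontrivial_kernel:
  fixes M :: "complex mat"
  assumes M: "M \<in> carrier_mat j (Suc j)"
  obtains x where "x \<in> carrier_vec (Suc j)" "x \<noteq> 0\<^sub>v (Suc j)" "M *\<^sub>v x = 0\<^sub>v j"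
proof -
  \<comment> \<open>appending a zero row gives a singular square matrix\<close>
  define N where "N = mat\<^sub>r (Suc j) (Suc j) 
      (\<lambda>i. if i = j then 0\<^sub>v (Suc j) else if i < j then row M i else 0\<^sub>v (Suc j))"
  have "det N = 0"
    unfolding N_def by (rule det_row_0) (use M in auto)
  then obtain x where x: "x \<in> carrier_vec (Suc j)" "x \<noteq> 0\<^sub>v (Suc j)" and Nx: "N *\<^sub>v x = 0\<^sub>v (Suc j)"
    using det_0_iff_vec_prod_zero[of N "Suc j"] by (auto simp: N_def)
  have "(M *\<^sub>v x) $ i = 0\<^sub>v j $ i" if "i < j" for i
  proof -
    have "row N i = row M i"
      using that M by (intro eq_vecI) (auto simp: N_def)
    then show ?thesis
      using arg_cong[OF Nx, of "\<lambda>v. v $ i"] that M by (simp add: N_def)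
  qed
  then have "M *\<^sub>v x = 0\<^sub>v j"
    by (intro eq_vecI) (use M in auto)
  with x show thesis using that by blast
qed

text \<open>The upper bound of the Courant--Fischer principle: if \<open>X\<close> stretches vectors by at most \<open>C\<close> on a
subspace given by \<open>j\<close> linear equations \<open>K x = 0\<close>, then \<open>\<sigma>\<^sub>j\<^sub>+\<^sub>1 \<le> C\<close>. The span of the first \<open>j + 1\<close> right
singular vectors meets that subspace in a nonzero vector, and \<open>X\<close> stretches every vector of the span
by at least \<open>\<sigma>\<^sub>j\<^sub>+\<^sub>1\<close>.\<close>
lemma singular_value_le_of_codim:
  assumes X: "X \<in> carrier_mat m p" and j: "j < min m p" and K: "K \<in> carrier_mat j p"
    and C: "0 \<le> C"
    and bound: "\<And>x. x \<in> carrier_vec p \<Longrightarrow> K *\<^sub>v x = 0\<^sub>v j \<Longrightarrow> vec_sqnorm (X *\<^sub>v x) \<le> C\<^sup>2 * vec_sqnorm x"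
  shows "singular_value (j + 1) X \<le> C"
proof -
  obtain U s where U: "U \<in> carrier_mat p p" and UU: "mat_adjoint U * U = 1\<^sub>m p"
    and gram: "mat_adjoint (X * U) * (X * U)
      = mat p p (\<lambda>(i, k). if i = k then complex_of_real ((s i)\<^sup>2) else 0)"
    and s: "\<forall>i<p. 0 \<le> s i" "\<forall>k<p. \<forall>i\<le>k. s k \<le> s i"
      "\<forall>k<min m p. singular_value (k + 1) X = s k"
    using singular_value_basis[OF X] .
  define Q where "Q = K * U"
  have Q: "Q \<in> carrier_mat j p"
    using K U by (simp add: Q_def)
  define M where "M = mat j (Suc j) (\<lambda>(i, k). Q $$ (i, k))"
  obtain z where z: "z \<in> carrier_vec (Suc j)" "z \<noteq> 0\<^sub>v (Suc j)" "M *\<^sub>v z = 0\<^sub>v j"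
    using underdetermined_nontrivial_kernel[of M j] by (auto simp: M_def)
  \<comment> \<open>\<open>z\<close> padded with zeros: the coordinates of a vector in the span of the first \<open>j + 1\<close> columns of \<open>U\<close>\<close>
  define y where "y = vec p (\<lambda>k. if k \<le> j then z $ k else 0)"
  have y: "y \<in> carrier_vec p" by (simp add: y_def)
  have cut: "(\<Sum>k<p. g k (y $ k)) = (\<Sum>k<Suc j. g k (z $ k))" if "\<And>k. g k 0 = 0"
    for g :: "nat \<Rightarrow> complex \<Rightarrow> 'b :: comm_monoid_add"
  proof -
    have "(\<Sum>k<p. g k (y $ k)) = (\<Sum>k<Suc j. g k (y $ k))"
      by (rule sum.mono_neutral_right) (use j that in \<open>auto simp: y_def\<close>)
    also have "\<dots> = (\<Sum>k<Suc j. g k (z $ k))"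
      by (rule sum.cong) (use j in \<open>auto simp: y_def\<close>)
    finally show ?thesis .
  qed
  have "Q *\<^sub>v y = M *\<^sub>v z"
  proof (rule eq_vecI)
    fix i assume "i < dim_vec (M *\<^sub>v z)"
    then have i: "i < j" by (simp add: M_def)
    have "(Q *\<^sub>v y) $ i = (\<Sum>k<p. Q $$ (i, k) * y $ k)"
      using i Q y by (simp add: scalar_prod_def lessThan_atLeast0)
    also have "\<dots> = (\<Sum>k<Suc j. Q $$ (i, k) * z $ k)"
      by (rule cut) simp
    also have "\<dots> = (M *\<^sub>v z) $ i"
      using i z(1) by (simp add: M_def scalar_prod_def lessThan_atLeast0)
    finally show "(Q *\<^sub>v y) $ i = (M *\<^sub>v z) $ i" .
  qed (use Q in \<open>simp add: M_def\<close>)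
  then have Ky: "K *\<^sub>v (U *\<^sub>v y) = 0\<^sub>v j"
    using K U y z(3) by (simp add: Q_def assoc_mult_mat_vec[of _ j p _ p])
  have norm_y: "vec_sqnorm y = vec_sqnorm z"
    using cut[of "\<lambda>_ u. (cmod u)\<^sup>2"] y z(1) by (simp add: vec_sqnorm_def del: sum.lessThan_Suc)
  have "(s j)\<^sup>2 * vec_sqnorm z = (\<Sum>k<Suc j. (s j)\<^sup>2 * (cmod (z $ k))\<^sup>2)"
    using z(1) by (simp add: vec_sqnorm_def sum_distrib_left del: sum.lessThan_Suc)
  also have "\<dots> \<le> (\<Sum>k<Suc j. (s k)\<^sup>2 * (cmod (z $ k))\<^sup>2)"
    by (intro sum_mono mult_right_mono power_mono) (use s j in auto)
  also have "\<dots> = (\<Sum>k<p. (s k)\<^sup>2 * (cmod (y $ k))\<^sup>2)"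
    by (rule cut [symmetric]) simp
  also have "\<dots> = vec_sqnorm ((X * U) *\<^sub>v y)"
    by (rule vec_sqnorm_mult_diag_gram[OF mult_carrier_mat[OF X U] y gram, symmetric])
  also have "\<dots> = vec_sqnorm (X *\<^sub>v (U *\<^sub>v y))"
    using X U y by (simp add: assoc_mult_mat_vec[of _ m p _ p])
  also have "\<dots> \<le> C\<^sup>2 * vec_sqnorm (U *\<^sub>v y)"
    by (rule bound[OF _ Ky]) (use U y in simp)
  also have "\<dots> = C\<^sup>2 * vec_sqnorm z"
    using vec_sqnorm_unitary[OF U y UU] norm_y by simp
  finally have "(s j)\<^sup>2 * vec_sqnorm z \<le> C\<^sup>2 * vec_sqnorm z" .
  moreover have "vec_sqnorm z > 0"
    using vec_sqnorm_nonneg[of z] vec_sqnorm_eq_0_iff[OF z(1)] z(2) by simp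
  ultimately have "(s j)\<^sup>2 \<le> C\<^sup>2"
    by (rule mult_right_le_imp_le)
  then have "s j \<le> C"
    using C by (rule power2_le_imp_le)
  then show ?thesis
    using s(3) j by simp
qed

section \<open>Vandermonde matrices\<close>

text \<open>The polynomial whose coefficients, in increasing order of degree, are the entries of the vector.\<close>
definition vec_poly :: "complex vec \<Rightarrow> complex poly" where
  "vec_poly x = (\<Sum>k<dim_vec x. monom (x $ k) k)"

lemma coeff_vec_poly: "coeff (vec_poly x) k = (if k < dim_vec x then x $ k else 0)"
  by (simp add: vec_poly_def coeff_sum)

lemma degree_vec_poly:
  assumes "0 < dim_vec x"
  shows "degree (vec_poly x) < dim_vec x"
proof -
  have "degree (vec_poly x) \<le> dim_vec x - 1"
    by (rule degree_le) (auto simp: coeff_vec_poly)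
  with assms show ?thesis by simp
qed

lemma vec_poly_vec_coeff:
  "degree q < n \<Longrightarrow> vec_poly (vec n (coeff q)) = q"
  by (rule poly_eqI) (auto simp: coeff_vec_poly coeff_eq_0)

lemma vec_sqnorm_eq_coeff_sqnorm:
  assumes "0 < dim_vec x"
  shows "vec_sqnorm x = coeff_sqnorm (vec_poly x)"
  using coeff_sqnorm_eq_sum[OF degree_vec_poly[OF assms]]
  by (simp add: vec_sqnorm_def coeff_vec_poly)

lemma vandermonde_mult_vec:
  assumes "x \<in> carrier_vec p" "i < m"
  shows "(vandermonde_mat m p \<alpha> *\<^sub>v x) $ i = poly (vec_poly x) (\<alpha> i)"
  using assms
  by (simp add: vandermonde_mat_def vec_poly_def scalar_prod_def poly_sum poly_monom
      lessThan_atLeast0 mult.commute)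

text \<open>The matrix of the linear map that sends the coefficient vector of a polynomial of degree less than
\<open>p\<close> to the coefficients of its remainder modulo \<open>B\<close>.\<close>
definition remainder_mat :: "nat \<Rightarrow> complex poly \<Rightarrow> complex mat" where
  "remainder_mat p B = mat (degree B) p (\<lambda>(i, k). coeff (monom 1 k mod B) i)"

lemma remainder_mat_kernel:
  assumes x: "x \<in> carrier_vec p" and B: "B \<noteq> 0"
    and ker: "remainder_mat p B *\<^sub>v x = 0\<^sub>v (degree B)"
  shows "B dvd vec_poly x"
proof -
  have "(\<Sum>k\<in>I. monom (x $ k) k) mod B = (\<Sum>k\<in>I. smult (x $ k) (monom 1 k mod B))"
    if "finite I" for I
    using that by induction (simp_all add: poly_mod_add_left smult_monom flip: mod_smult_left)
  then have mod_eq: "vec_poly x mod B = (\<Sum>k<p. smult (x $ k) (monom 1 k mod B))"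
    using x by (simp add: vec_poly_def)
  have "coeff (vec_poly x mod B) i = 0" if "i < degree B" for i
    using arg_cong[OF ker, of "\<lambda>v. v $ i"] x that
    by (simp add: remainder_mat_def mod_eq coeff_sum scalar_prod_def lessThan_atLeast0 mult.commute)
  moreover have "vec_poly x mod B = 0 \<or> degree (vec_poly x mod B) < degree B"
    by (rule degree_mod_less[OF B])
  ultimately have "vec_poly x mod B = 0"
    by (metis leading_coeff_0_iff)
  then show ?thesis by (simp add: dvd_eq_mod_eq_0)
qed

text \<open>If the polynomial of \<open>x\<close> is \<open>(z - b)\<^sup>j g\<close>, let \<open>y\<close> be the coefficient vector of \<open>(1 - cnj b * z)\<^sup>j g\<close>. Then
\<open>x\<close> and \<open>y\<close> have the same norm, and at each node the modulus of the first polynomial is at most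
\<open>h\<^sup>-\<^sup>j\<close> times that of the second.\<close>
lemma vandermonde_sqnorm_le_of_root:
  assumes p: "0 < p" and m: "0 < m" and x: "x \<in> carrier_vec p" and h: "0 < h"
    and dvd: "[:- b, 1:] ^ j dvd vec_poly x"
    and nodes: "\<And>i. i < m \<Longrightarrow> h * cmod (\<alpha> i - b) \<le> cmod (1 - cnj b * \<alpha> i)"
  defines "V \<equiv> vandermonde_mat m p \<alpha>"
  shows "vec_sqnorm (V *\<^sub>v x) \<le> (spectral_norm V / h ^ j)\<^sup>2 * vec_sqnorm x"
proof -
  have V: "V \<in> carrier_mat m p" by (simp add: V_def vandermonde_mat_def)
  obtain g where g: "vec_poly x = [:- b, 1:] ^ j * g"
    using dvd by (rule dvdE)
  define q where "q = [:1, - cnj b:] ^ j * g"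
  define y where "y = vec p (coeff q)"
  \<comment> \<open>the degree does not grow, since \<open>1 - cnj b * z\<close> has degree at most one, so \<open>q\<close> fits into \<open>p\<close> entries\<close>
  have "degree q \<le> degree (vec_poly x)"
  proof (cases "g = 0")
    case False
    have "degree q \<le> degree ([:1, - cnj b:] ^ j) + degree g"
      unfolding q_def by (rule degree_mult_le)
    also have "degree ([:1, - cnj b:] ^ j) \<le> j"
      using degree_power_le[of "[:1, - cnj b:]" j] degree_pCons_le[of 1 "[:- cnj b:]"]
      by (metis degree_pCons_0 le_trans mult_le_mono1 nat_mult_1 One_nat_def)
    also have "j + degree g = degree (vec_poly x)"
      using False unfolding g by (subst degree_mult_eq) (auto simp: degree_power_eq)
    finally show ?thesis by simp
  qed (simp add: q_def)
  then have "degree q < p"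
    using degree_vec_poly[of x] x p by simp
  then have y_poly: "vec_poly y = q"
    unfolding y_def by (rule vec_poly_vec_coeff)
  have y: "y \<in> carrier_vec p" by (simp add: y_def)
  have norm_y: "vec_sqnorm y = vec_sqnorm x"
    using vec_sqnorm_eq_coeff_sqnorm[of y] vec_sqnorm_eq_coeff_sqnorm[of x] x y p
      coeff_sqnorm_reflect_root_power[of b j g] by (simp add: y_poly q_def g)
  have pointwise: "h ^ j * cmod ((V *\<^sub>v x) $ i) \<le> cmod ((V *\<^sub>v y) $ i)" if i: "i < m" for i
  proof -
    have "h ^ j * cmod ((V *\<^sub>v x) $ i) = (h * cmod (\<alpha> i - b)) ^ j * cmod (poly g (\<alpha> i))"
      unfolding V_def vandermonde_mult_vec[OF x i] g
      by (simp add: norm_mult norm_power power_mult_distrib algebra_simps)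
    also have "\<dots> \<le> cmod (1 - cnj b * \<alpha> i) ^ j * cmod (poly g (\<alpha> i))"
      by (intro mult_right_mono power_mono nodes[OF i]) (use h in auto)
    also have "\<dots> = cmod ((V *\<^sub>v y) $ i)"
      unfolding V_def vandermonde_mult_vec[OF y i] y_poly q_def
      by (simp add: norm_mult norm_power algebra_simps)
    finally show ?thesis .
  qed
  have "(h ^ j)\<^sup>2 * vec_sqnorm (V *\<^sub>v x) = (\<Sum>i<m. (h ^ j * cmod ((V *\<^sub>v x) $ i))\<^sup>2)"
    using V by (simp add: vec_sqnorm_def sum_distrib_left power_mult_distrib)
  also have "\<dots> \<le> (\<Sum>i<m. (cmod ((V *\<^sub>v y) $ i))\<^sup>2)"
    by (intro sum_mono power_mono pointwise) (use h in auto)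
  also have "\<dots> = vec_sqnorm (V *\<^sub>v y)"
    using V by (simp add: vec_sqnorm_def)
  also have "\<dots> \<le> (spectral_norm V)\<^sup>2 * vec_sqnorm x"
    using vec_sqnorm_mult_le_spectral_norm[OF V _ y] m p norm_y by simp
  finally show ?thesis
    using h by (simp add: power_divide field_simps)
qed

lemma spectral_norm_nonneg:
  assumes X: "X \<in> carrier_mat m p" and "0 < min m p"
  shows "0 \<le> spectral_norm X"
proof -
  obtain U s where "\<forall>i<p. 0 \<le> s i" "\<forall>k<min m p. singular_value (k + 1) X = s k"
    using singular_value_basis[OF X] by metis
  with assms(2) show ?thesis
    unfolding spectral_norm_def by (metis add_0 min_less_iff_conj)
qed

text \<open>Vectors whose polynomial is divisible by \<open>(z - b)\<^sup>j\<close> form a subspace given by \<open>j\<close> equations.\<close>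
lemma vandermonde_singular_value_decay:
  assumes j: "j < min m p" and h: "0 < h"
    and nodes: "\<And>i. i < m \<Longrightarrow> h * cmod (\<alpha> i - b) \<le> cmod (1 - cnj b * \<alpha> i)"
  shows "singular_value (j + 1) (vandermonde_mat m p \<alpha>)
    \<le> spectral_norm (vandermonde_mat m p \<alpha>) / h ^ j"
proof (rule singular_value_le_of_codim)
  let ?V = "vandermonde_mat m p \<alpha>" and ?B = "[:- b, 1:] ^ j"
  show V: "?V \<in> carrier_mat m p" by (simp add: vandermonde_mat_def)
  have deg: "degree ?B = j" by (simp add: degree_power_eq)
  show "remainder_mat p ?B \<in> carrier_mat j p" by (simp add: remainder_mat_def deg)
  show "0 \<le> spectral_norm ?V / h ^ j"
    using spectral_norm_nonneg[OF V] j h by simp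
  show "vec_sqnorm (?V *\<^sub>v x) \<le> (spectral_norm ?V / h ^ j)\<^sup>2 * vec_sqnorm x"
    if x: "x \<in> carrier_vec p" and ker: "remainder_mat p ?B *\<^sub>v x = 0\<^sub>v j" for x
  proof (rule vandermonde_sqnorm_le_of_root[OF _ _ x h _ nodes])
    show "?B dvd vec_poly x"
      using remainder_mat_kernel[OF x, of ?B] ker by (simp only: deg) auto
  qed (use j in auto)
qed (rule j)

section \<open>Nodes in a disk inside the unit disk\<close>

theorem lemma7p1:
  fixes m p j :: nat
    and \<alpha> :: "nat \<Rightarrow> complex"
    and z\<^sub>0 :: complex
    and \<eta>\<^sub>0 c \<beta> h :: real
    and E :: "complex set"
  assumes "\<eta>\<^sub>0 > 0"
    and "z\<^sub>0 \<noteq> 0"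
    and E_def: "E = {z. cmod (z - z\<^sub>0) < \<eta>\<^sub>0}"
    and "E \<subseteq> {z. cmod z < 1}"
    and nodes_distinct: "inj_on \<alpha> {..<m}"
    and nodes_in_E: "\<And>i. i < m \<Longrightarrow> \<alpha> i \<in> E"
    and c_def: "c = (cmod z\<^sub>0)\<^sup>2 - \<eta>\<^sub>0\<^sup>2"
    and \<beta>_def: "\<beta> = 1 / (2 * cmod z\<^sub>0) * (1 + c - sqrt ((1 + c)\<^sup>2 - 4 * (cmod z\<^sub>0)\<^sup>2))"
    and h_def: "h = cmod ((z\<^sub>0 - complex_of_real (cmod z\<^sub>0) * complex_of_real \<beta> * (z\<^sub>0 + complex_of_real \<eta>\<^sub>0))
                        / (complex_of_real (cmod z\<^sub>0) * (z\<^sub>0 + complex_of_real \<eta>\<^sub>0) - complex_of_real \<beta> * z\<^sub>0))"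
    and h_well_defined:
      "complex_of_real (cmod z\<^sub>0) * (z\<^sub>0 + complex_of_real \<eta>\<^sub>0) - complex_of_real \<beta> * z\<^sub>0 \<noteq> 0"
    and "j < min m p"
  shows "singular_value (j + 1) (vandermonde_mat m p \<alpha>)
           \<le> h powi (- int j) * spectral_norm (vandermonde_mat m p \<alpha>)"
proof -
  define r where "r = cmod z\<^sub>0"
  \<comment> \<open>\<open>b\<close> is \<open>\<beta>\<close> turned to the direction of \<open>z\<^sub>0\<close>; \<open>w\<close> is a point of the boundary circle\<close>
  define t where "t = \<beta> / r"
  define b where "b = complex_of_real t * z\<^sub>0"
  define w where "w = z\<^sub>0 + complex_of_real \<eta>\<^sub>0"
  have r: "r > 0" using assms(2) by (simp add: r_def)
  have c: "c = r\<^sup>2 - \<eta>\<^sub>0\<^sup>2" by (simp add: c_def r_def)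
  \<comment> \<open>otherwise the disk would contain the point of the unit circle on the ray through \<open>z\<^sub>0\<close>\<close>
  have tangent: "r + \<eta>\<^sub>0 \<le> 1"
  proof (rule ccontr)
    assume far: "\<not> r + \<eta>\<^sub>0 \<le> 1"
    have "z\<^sub>0 \<in> E" using assms(1) by (simp add: E_def)
    then have "r < 1" using assms(4) by (auto simp: r_def)
    define u where "u = complex_of_real (1 / r) * z\<^sub>0"
    have "u - z\<^sub>0 = complex_of_real (1 / r - 1) * z\<^sub>0"
      by (simp add: u_def algebra_simps)
    then have "cmod (u - z\<^sub>0) = \<bar>1 / r - 1\<bar> * r"
      by (simp only: norm_mult norm_of_real r_def)
    also have "\<dots> = 1 - r"
      using r \<open>r < 1\<close> by (simp add: abs_if field_simps)
    finally have "u \<in> E" using far by (simp add: E_def)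
    moreover have "cmod u = 1"
      using r by (simp add: u_def norm_divide r_def)
    ultimately show False using assms(4) by auto
  qed
  define D where "D = (1 + c)\<^sup>2 - 4 * r\<^sup>2"
  have D_factor: "D = (1 + c - 2 * r) * (1 + c + 2 * r)"
    by (simp add: D_def power2_eq_square algebra_simps)
  have gap: "0 \<le> 1 + c - 2 * r"
  proof -
    have "\<eta>\<^sub>0\<^sup>2 \<le> (1 - r)\<^sup>2"
      using tangent assms(1) by (intro power_mono) auto
    then show ?thesis by (simp add: c power2_eq_square algebra_simps)
  qed
  have D: "0 \<le> D" "1 + c - 2 * r \<le> sqrt D" "sqrt D \<le> 1 + c"
  proof -
    show "0 \<le> D" using gap r by (simp add: D_factor)
    have "(1 + c - 2 * r)\<^sup>2 \<le> D"
      unfolding D_factor power2_eq_square using gap r by (intro mult_left_mono) auto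
    then show "1 + c - 2 * r \<le> sqrt D" by (rule real_le_rsqrt)
    show "sqrt D \<le> 1 + c"
      by (rule real_le_lsqrt) (use gap r in \<open>auto simp: D_def\<close>)
  qed
  have \<beta>: "\<beta> = (1 + c - sqrt D) / (2 * r)"
    by (simp add: \<beta>_def D_def r_def)
  have \<beta>01: "0 \<le> \<beta>" "\<beta> \<le> 1"
    using D r by (simp_all add: \<beta> field_simps)
  \<comment> \<open>\<open>\<beta>\<close> is the smaller root of \<open>r x\<^sup>2 - (1 + c) x + r\<close>\<close>
  have "(2 * r * \<beta> - (1 + c))\<^sup>2 = D"
    using D(1) r by (simp add: \<beta>)
  then have "r * (r * \<beta>\<^sup>2 - (1 + c) * \<beta> + r) = 0"
    by (simp add: D_def power2_eq_square algebra_simps)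
  then have "r * \<beta>\<^sup>2 - (1 + c) * \<beta> + r = 0"
    using r by simp
  moreover have "\<beta> = t * r" using r by (simp add: t_def)
  ultimately have "r * (t\<^sup>2 * r\<^sup>2 - (1 + c) * t + 1) = 0"
    by (simp add: power2_eq_square algebra_simps)
  then have t: "t\<^sup>2 * r\<^sup>2 - (1 + c) * t + 1 = 0"
    using r by simp
  have b1: "cmod b \<le> 1"
    using \<beta>01 r by (simp add: b_def norm_mult norm_divide t_def r_def)
  have dist_w: "cmod (w - z\<^sub>0) = \<eta>\<^sub>0"
    using assms(1) by (simp add: w_def)
  have w1: "cmod w \<le> 1"
    using norm_triangle_ineq[of z\<^sub>0 "complex_of_real \<eta>\<^sub>0"] tangent assms(1) by (simp add: w_def r_def)
  have rr: "complex_of_real r * complex_of_real r = z\<^sub>0 * cnj z\<^sub>0"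
    using complex_norm_square[of "z\<^sub>0"] by (simp add: r_def power2_eq_square)
  have b_r: "complex_of_real r * b = complex_of_real \<beta> * z\<^sub>0"
    using r by (simp add: b_def t_def)
  have den: "complex_of_real r * w - complex_of_real \<beta> * z\<^sub>0 = complex_of_real r * (w - b)"
    by (simp add: right_diff_distrib b_r)
  have num: "z\<^sub>0 - complex_of_real r * complex_of_real \<beta> * w = z\<^sub>0 * (1 - cnj b * w)"
  proof -
    have "z\<^sub>0 * cnj b = complex_of_real t * (z\<^sub>0 * cnj z\<^sub>0)"
      by (simp add: b_def)
    also have "\<dots> = complex_of_real r * complex_of_real \<beta>"
      unfolding rr [symmetric] using r by (simp add: t_def)
    finally show ?thesis by (simp add: right_diff_distrib flip: mult.assoc)
  qed
  have wb: "w \<noteq> b"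
    using h_well_defined unfolding r_def[symmetric] w_def[symmetric] den by auto
  have h: "h = cmod (1 - cnj b * w) / cmod (w - b)"
    unfolding h_def r_def[symmetric] w_def[symmetric] den num
    using r by (simp add: norm_divide norm_mult flip: r_def)
  have "0 < cmod (w - b)"
    using wb by simp
  moreover have "cmod (w - b) \<le> cmod (1 - cnj b * w)"
    using blaschke_le_one[OF b1 w1] .
  ultimately have h_pos: "0 < h"
    unfolding h by (intro divide_pos_pos) linarith+
  have nodes: "h * cmod (\<alpha> i - b) \<le> cmod (1 - cnj b * \<alpha> i)" if "i < m" for i
  proof -
    have "cmod (\<alpha> i - z\<^sub>0) \<le> \<eta>\<^sub>0"
      using nodes_in_E[OF that] by (simp add: E_def)
    from disk_blaschke_bound[OF b_def r_def c t b1 w1 dist_w this]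
    have "cmod (1 - cnj b * w) * cmod (\<alpha> i - b) \<le> cmod (1 - cnj b * \<alpha> i) * cmod (w - b)"
      by (simp only: mult.commute)
    then show ?thesis
      unfolding h using wb by (simp add: pos_divide_le_eq)
  qed
  show ?thesis
    using vandermonde_singular_value_decay[OF assms(11) h_pos nodes]
    by (simp add: power_int_minus divide_inverse mult.commute)
qed

end
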